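(* For a set $S$, let $G_S$ be the set-system hypergraph with $V(G_S)=S$, $E(G_S)=\{1\}$ and $\epsilon_{G_S}(1)=S$, and let $V^{\diamond}(\{1\})$ be the set-system hypergraph with one vertex and no edges. The class $\mathscr{G}:=\{G_S:S\text{ a set}\}\cup\{V^{\diamond}(\{1\})\}$ is a family of generators for $\mathfrak{H}$. If $\mathscr{J}$ is any family of generators for $\mathfrak{H}$, then $\mathscr{J}$ is a proper class. Consequently, $\mathscr{G}$ is a minimal family of generators.
   Context: A set-system hypergraph $G$ consists of sets $V(G)$, $E(G)$ and a function $\epsilon_G:E(G)\to\mathcal{P}(V(G))$ (edges may be empty). A morphism $\phi:G\to H$ is a pair of functions $V(\phi):V(G)\to V(H)$, $E(\phi):E(G)\to E(H)$ with $\epsilon_H\circ E(\phi)=\mathcal{P}V(\phi)\circ\epsilon_G$, where $\mathcal{P}f(A)=\{f(a):a\in A\}$. This forms the category $\mathfrak{H}$. A family $\mathscr{J}$ of objects is a family of generators if for any parallel morphisms $\phi\neq\psi:X\to Y$ there exist $J\in\mathscr{J}$ and $\varphi:J\to X$ with $\phi\circ\varphi\neq\psi\circ\varphi$. *)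

theory Defs
  imports Main "HOL-Library.FuncSet" "HOL-Library.Equipollence"
begin

text \<open>
  The ambient set theory. The elements of the type \<open>'u\<close> are the sets, and \<open>elts x\<close> is the
  collection of all members of the set \<open>x\<close>. A class of sets is an arbitrary HOL set of type
  \<open>'u set\<close>; it is a set iff it lies in \<open>range elts\<close>. The axioms are those of ZFC, with
  Separation and Replacement for arbitrary classes (as in Morse-Kelley class theory). Choice
  comes from the Hilbert choice of HOL by way of Replacement; the empty set comes from Infinity;
  pairing comes from Replacement and Powerset.
\<close>

locale zfc_universe =
  fixes elts :: "'u \<Rightarrow> 'u set"
  assumes extensionality: "inj elts"
    and foundation: "wf {(x, y). x \<in> elts y}"
    and separation: "A \<subseteq> elts x \<Longrightarrow> A \<in> range elts"
    and union: "(\<Union>y\<in>elts x. elts y) \<in> range elts"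
    and powerset: "{y. elts y \<subseteq> elts x} \<in> range elts"
    and replacement: "f ` elts x \<in> range elts"
    and infinity: "\<exists>w. (\<exists>z\<in>elts w. elts z = {}) \<and>
                       (\<forall>x\<in>elts w. \<exists>y\<in>elts w. elts y = insert x (elts x))"

text \<open>
  For classes of hypergraphs, which are not of type \<open>'u set\<close>: by Replacement, a class is a set
  iff it is in bijection with a set.
\<close>

definition proper_class :: "('u \<Rightarrow> 'u set) \<Rightarrow> 'a set \<Rightarrow> bool" where
  "proper_class elts C \<longleftrightarrow> \<not> (\<exists>x. C \<approx> elts x)"

definition empty_elt :: "('u \<Rightarrow> 'u set) \<Rightarrow> 'u" where
  "empty_elt elts = (THE z. elts z = {})"

text \<open>The von Neumann ordinal 1.\<close>

definition one_elt :: "('u \<Rightarrow> 'u set) \<Rightarrow> 'u" where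
  "one_elt elts = (THE z. elts z = {empty_elt elts})"

text \<open>
  Incidence functions and the components of morphisms are extensional (undefined outside their
  domain), so that HOL equality is equality of hypergraphs and of morphisms.
\<close>

record 'u hypergraph =
  verts :: "'u set"
  edges :: "'u set"
  inc :: "'u \<Rightarrow> 'u set"

definition set_system_hypergraphs :: "('u \<Rightarrow> 'u set) \<Rightarrow> 'u hypergraph set" where
  "set_system_hypergraphs elts =
     {G. verts G \<in> range elts \<and> edges G \<in> range elts \<and> inc G \<in> edges G \<rightarrow>\<^sub>E Pow (verts G)}"

type_synonym 'u hmorphism = "('u \<Rightarrow> 'u) \<times> ('u \<Rightarrow> 'u)"

definition hhom :: "'u hypergraph \<Rightarrow> 'u hypergraph \<Rightarrow> 'u hmorphism set" where
  "hhom G H =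
     {(f, g). f \<in> verts G \<rightarrow>\<^sub>E verts H \<and> g \<in> edges G \<rightarrow>\<^sub>E edges H \<and>
              (\<forall>e\<in>edges G. inc H (g e) = f ` inc G e)}"

text \<open>\<open>hcomp G \<phi> \<psi>\<close> is \<open>\<phi> \<circ> \<psi>\<close>, where \<open>G\<close> is the domain of \<open>\<psi>\<close>.\<close>

definition hcomp :: "'u hypergraph \<Rightarrow> 'u hmorphism \<Rightarrow> 'u hmorphism \<Rightarrow> 'u hmorphism" where
  "hcomp G \<phi> \<psi> =
     (compose (verts G) (fst \<phi>) (fst \<psi>), compose (edges G) (snd \<phi>) (snd \<psi>))"

definition family_of_generators :: "('u \<Rightarrow> 'u set) \<Rightarrow> 'u hypergraph set \<Rightarrow> bool" where
  "family_of_generators elts \<J> \<longleftrightarrow>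
     \<J> \<subseteq> set_system_hypergraphs elts \<and>
     (\<forall>X\<in>set_system_hypergraphs elts. \<forall>Y\<in>set_system_hypergraphs elts.
        \<forall>\<phi>\<in>hhom X Y. \<forall>\<psi>\<in>hhom X Y. \<phi> \<noteq> \<psi> \<longrightarrow>
          (\<exists>J\<in>\<J>. \<exists>\<theta>\<in>hhom J X. hcomp J \<phi> \<theta> \<noteq> hcomp J \<psi> \<theta>))"

text \<open>
  Minimality refers to size: \<open>\<J>\<close> injects into every family of generators. Minimality for
  inclusion is not meant: for a nonempty set \<open>S\<close>, the hypergraph \<open>G\<^sub>S\<close> can be dropped from the
  family below, since \<open>G\<^sub>T\<close> for any other \<open>T\<close> that maps onto \<open>S\<close> does its work.
\<close>

definition minimal_family_of_generators :: "('u \<Rightarrow> 'u set) \<Rightarrow> 'u hypergraph set \<Rightarrow> bool" where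
  "minimal_family_of_generators elts \<J> \<longleftrightarrow>
     family_of_generators elts \<J> \<and> (\<forall>\<K>. family_of_generators elts \<K> \<longrightarrow> \<J> \<lesssim> \<K>)"

definition one_edge_hypergraph :: "('u \<Rightarrow> 'u set) \<Rightarrow> 'u set \<Rightarrow> 'u hypergraph" where
  "one_edge_hypergraph elts S =
     \<lparr>verts = S, edges = {one_elt elts}, inc = (\<lambda>e\<in>{one_elt elts}. S)\<rparr>"

definition one_vertex_hypergraph :: "('u \<Rightarrow> 'u set) \<Rightarrow> 'u hypergraph" where
  "one_vertex_hypergraph elts = \<lparr>verts = {one_elt elts}, edges = {}, inc = (\<lambda>e. undefined)\<rparr>"

definition standard_generators :: "('u \<Rightarrow> 'u set) \<Rightarrow> 'u hypergraph set" where
  "standard_generators elts =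
     {one_edge_hypergraph elts S | S. S \<in> range elts} \<union> {one_vertex_hypergraph elts}"

context zfc_universe
begin

lemma elts_empty_elt: "elts (empty_elt elts) = {}"
  unfolding empty_elt_def
  by (rule theI') (use infinity extensionality in \<open>auto dest: injD\<close>)

lemma singleton_set: "{a} \<in> range elts"
proof -
  have "{y. elts y \<subseteq> elts (empty_elt elts)} \<in> range elts" by (rule powerset)
  moreover have "{y. elts y \<subseteq> elts (empty_elt elts)} = {empty_elt elts}"
    using extensionality by (auto simp: elts_empty_elt dest: injD[where y = "empty_elt elts"])
  ultimately obtain x where "elts x = {empty_elt elts}" by auto
  then show ?thesis using replacement[of "\<lambda>_. a" x] by auto
qed

lemma elts_one_elt: "elts (one_elt elts) = {empty_elt elts}"
  unfolding one_elt_def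
proof (rule theI')
  show "\<exists>!z. elts z = {empty_elt elts}"
    using singleton_set[of "empty_elt elts"] extensionality by (metis imageE injD)
qed

lemma standard_generators_subset: "standard_generators elts \<subseteq> set_system_hypergraphs elts"
proof -
  have "{} \<in> range elts" using elts_empty_elt by (metis rangeI)
  then show ?thesis
    using singleton_set
    by (auto simp: standard_generators_def set_system_hypergraphs_def one_edge_hypergraph_def
        one_vertex_hypergraph_def)
qed

end

lemma hcomp_in_hhom:
  assumes "\<psi> \<in> hhom G H" "\<phi> \<in> hhom H K" "inc G \<in> edges G \<rightarrow> Pow (verts G)"
  shows "hcomp G \<phi> \<psi> \<in> hhom G K"
proof -
  obtain f g f' g' where [simp]: "\<psi> = (f, g)" "\<phi> = (f', g')" by (metis surj_pair)
  have "inc K (g' (g e)) = compose (verts G) f' f ` inc G e" if "e \<in> edges G" for e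
  proof -
    have "inc G e \<subseteq> verts G" using assms(3) that by auto
    then have "compose (verts G) f' f ` inc G e = f' ` f ` inc G e"
      by (force simp: compose_def image_image intro!: image_cong)
    moreover have "g e \<in> edges H" using assms(1) that by (auto simp: hhom_def)
    ultimately show ?thesis using assms(1,2) that by (auto simp: hhom_def)
  qed
  then show ?thesis using assms(1,2)
    by (auto simp: hhom_def hcomp_def compose_def PiE_iff)
qed

end

theory Submission imports Defs begin

text \<open>
  Two vertex maps are separated by the one-vertex hypergraph, two edge maps that differ at \<open>e\<close> by
  the one-edge hypergraph on the set of endpoints of \<open>e\<close>. Conversely, the two edge maps from
  \<open>G\<^sub>S\<close> to the hypergraph with two parallel edges on \<open>S\<close> are only separated by hypergraphs with
  at least \<open>|S|\<close> vertices, so the vertex sets in a family of generators are unbounded in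
  cardinality. Minimality then rests on limitation of size: a proper class \<open>M\<close> of least cardinality
  is well-ordered with all proper initial segments sets, hence indexes a cumulative hierarchy
  exhausting the universe; each level is a set, so the universe is no larger than \<open>M\<close>.
\<close>

unbundle cardinal_syntax

lemma lepoll_iff_card_of: "A \<lesssim> B \<longleftrightarrow> |A| \<le>o |B|"
  by (simp only: lepoll_def card_of_ordLeq)

text \<open>The cumulative hierarchy along \<open>r\<close>: level \<open>k\<close> is the power
  class of the union of all earlier levels. As a least fixed point it gets its recursion equation by
  mere unfolding.\<close>

inductive in_level :: "('u \<Rightarrow> 'u set) \<Rightarrow> 'u rel \<Rightarrow> 'u \<Rightarrow> 'u \<Rightarrow> bool"
  for elts :: "'u \<Rightarrow> 'u set" and r :: "'u rel" where
  in_levelI: "(\<And>y. y \<in> elts x \<Longrightarrow> \<exists>j\<in>underS r k. in_level elts r j y) \<Longrightarrow> in_level elts r k x"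

lemma in_level_iff:
  "in_level elts r k x \<longleftrightarrow> elts x \<subseteq> (\<Union>j\<in>underS r k. {y. in_level elts r j y})"
  by (subst in_level.simps) blast

context zfc_universe
begin

section \<open>Closure properties of sets\<close>

lemma subset_set: "A \<subseteq> B \<Longrightarrow> B \<in> range elts \<Longrightarrow> A \<in> range elts"
  using separation by blast

lemma image_set: "A \<in> range elts \<Longrightarrow> f ` A \<in> range elts"
  using replacement by blast

lemma UNION_set:
  assumes "I \<in> range elts" "\<And>i. i \<in> I \<Longrightarrow> A i \<in> range elts"
  shows "(\<Union>i\<in>I. A i) \<in> range elts"
proof -
  have "\<forall>i\<in>I. \<exists>a. A i = elts a" using assms(2) by blast
  then obtain a where a: "\<forall>i\<in>I. A i = elts (a i)" by metis
  obtain x where "a ` I = elts x" using image_set[OF assms(1)] by blast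
  then have "(\<Union>i\<in>I. A i) = (\<Union>y\<in>elts x. elts y)" using a by force
  then show ?thesis using union by simp
qed

lemma insert_set:
  assumes "A \<in> range elts"
  shows "insert a A \<in> range elts"
proof -
  obtain x where x: "A = elts x" using assms by blast
  \<comment> \<open>Singletons in the power set of \<open>x\<close> give back the members of
    \<open>x\<close>; all other subsets, the empty one among them, give \<open>a\<close>.\<close>
  define f where "f y = (if \<exists>z. elts y = {z} then THE z. elts y = {z} else a)" for y
  have fa: "f (empty_elt elts) = a" by (simp add: f_def elts_empty_elt)
  have fs: "f y = z" if "elts y = {z}" for y z using that by (auto simp: f_def)
  have "f ` {y. elts y \<subseteq> elts x} = insert a A"
  proof (intro equalityI subsetI)
    fix z assume "z \<in> f ` {y. elts y \<subseteq> elts x}"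
    then show "z \<in> insert a A" using x fs by (auto simp: f_def)
  next
    fix z assume z: "z \<in> insert a A"
    show "z \<in> f ` {y. elts y \<subseteq> elts x}"
    proof (cases "z = a")
      case True
      then show ?thesis using fa by (force simp: elts_empty_elt)
    next
      case False
      obtain y where y: "elts y = {z}" using singleton_set[of z] by (metis imageE)
      then show ?thesis using fs[OF y] False z x by force
    qed
  qed
  then show ?thesis using image_set[OF powerset, of f x] by simp
qed

lemma finite_set: "finite A \<Longrightarrow> A \<in> range elts"
proof (induction rule: finite_induct)
  case empty
  then show ?case using elts_empty_elt by (metis rangeI)
qed (rule insert_set)

lemma UNIV_not_set: "UNIV \<notin> range elts"
proof
  assume "UNIV \<in> range elts"
  then obtain d where "{x. x \<notin> elts x} = elts d" using subset_set[OF subset_UNIV] by blast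
  then show False by blast
qed

text \<open>An injection of \<open>A\<close> into \<open>B\<close> reverses to a map under which the
  image of \<open>B\<close> covers \<open>A\<close>, so Replacement and Separation apply.\<close>

lemma set_if_card_le:
  assumes "|A| \<le>o |B|" "B \<in> range elts"
  shows "A \<in> range elts"
proof -
  obtain g where "A \<subseteq> g ` B"
    using assms(1) by (auto simp: lepoll_iff simp flip: lepoll_iff_card_of)
  then show ?thesis using subset_set image_set assms(2) by metis
qed

section \<open>Von Neumann's limitation of size\<close>

theorem limitation_of_size:
  assumes "A \<notin> range elts"
  shows "|UNIV :: 'u set| \<le>o |A|"
proof -
  \<comment> \<open>The choice operator of HOL well-orders every class, and cardinals are
    well-founded; \<open>A\<close> itself witnesses that there is a candidate.\<close>
  obtain M where M: "M \<notin> range elts" and least: "\<And>B. B \<notin> range elts \<Longrightarrow> |M| \<le>o |B|"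
  proof -
    let ?R = "card_of ` (- range elts)"
    have "\<exists>r\<in>?R. \<forall>r'\<in>?R. r \<le>o r'"
      using assms card_of_Card_order by (intro exists_minim_Card_order) blast+
    then show ?thesis using that by blast
  qed
  let ?r = "|M|"
  let ?V = "\<lambda>k. {x. in_level elts ?r k x}"
  have fieldr: "Field ?r = M" by (rule Field_card_of)
  have infM: "infinite M" using finite_set M by blast
  \<comment> \<open>Proper initial segments of a cardinal order are strictly smaller, so by
    minimality of \<open>M\<close> they are sets.\<close>
  have seg: "underS ?r k \<in> range elts" if "k \<in> M" for k
  proof -
    have "|underS ?r k| <o ?r" using that fieldr by (intro card_of_underS card_of_Card_order) simp
    then show ?thesis using least not_ordLess_ordLeq by blast
  qed
  have underS_M: "underS ?r k \<subseteq> M" for k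
    using FieldI1[of _ k ?r] fieldr by (auto simp: underS_def)
  have wo_rel: "wo_rel ?r" by (simp add: wo_rel_def card_of_Well_order)
  have level: "?V k \<in> range elts" if "k \<in> M" for k
    using that
  proof (induction k rule: wo_rel.well_order_induct[OF wo_rel])
    case (1 k)
    have "?V j \<in> range elts" if "j \<in> underS ?r k" for j
    proof (rule 1(1)[rule_format])
      show "j \<noteq> k \<and> (j, k) \<in> ?r" using that by (simp add: underS_def)
      show "j \<in> M" using that underS_M by blast
    qed
    then have "(\<Union>j\<in>underS ?r k. ?V j) \<in> range elts"
      by (intro UNION_set seg 1(2))
    then obtain u where "(\<Union>j\<in>underS ?r k. ?V j) = elts u" by blast
    then have "?V k = {x. elts x \<subseteq> elts u}" using in_level_iff[of elts ?r k] by simp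
    then show ?case using powerset by simp
  qed
  \<comment> \<open>Regularity of \<open>M\<close>: a union of sets over a set of indices cannot
    exhaust a proper class.\<close>
  have bounded: "\<exists>k\<in>M. J \<subseteq> underS ?r k" if "J \<in> range elts" "J \<subseteq> M" for J
  proof -
    \<comment> \<open>Moving from \<open>j\<close> up to some \<open>s j\<close> makes the bound
      strict: \<open>k\<close> outside the segment below \<open>s j\<close> only yields
      \<open>s j \<le> k\<close>, hence \<open>j < k\<close>.\<close>
    have "\<exists>s\<in>M. (j, s) \<in> ?r \<and> j \<noteq> s" if "j \<in> M" for j
      using infinite_Card_order_limit[OF card_of_Card_order, of M j] infM that fieldr by auto
    then obtain s where s: "\<And>j. j \<in> M \<Longrightarrow> s j \<in> M \<and> (j, s j) \<in> ?r \<and> j \<noteq> s j" by metis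
    have "(\<Union>j\<in>J. underS ?r (s j)) \<in> range elts"
      using that s by (intro UNION_set seg) auto
    then have "\<not> M \<subseteq> (\<Union>j\<in>J. underS ?r (s j))" using M subset_set by metis
    then obtain k where k: "k \<in> M" "k \<notin> (\<Union>j\<in>J. underS ?r (s j))" by blast
    have "j \<in> underS ?r k" if "j \<in> J" for j
    proof -
      have j: "j \<in> M" using that \<open>J \<subseteq> M\<close> by blast
      have "(k, s j) \<notin> ?r \<or> k = s j" using k(2) that by (auto simp: underS_def)
      then have "(s j, k) \<in> ?r"
        by (rule wo_rel.in_notinI[OF wo_rel]) (use k s[OF j] fieldr in auto)
      then show ?thesis
        using wo_rel.TRANS[OF wo_rel] wo_rel.ANTISYM[OF wo_rel] s[OF j]
        unfolding underS_def by (auto dest: transD antisymD)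
    qed
    then show ?thesis using k by blast
  qed
  \<comment> \<open>Induction on membership: by Replacement the level indices of the members of
    \<open>x\<close> form a set, and any strict bound of it is a level for \<open>x\<close>.\<close>
  have exhaust: "\<exists>k\<in>M. x \<in> ?V k" for x
    using foundation
  proof (induction x rule: wf_induct_rule)
    case (less x)
    then have "\<forall>y\<in>elts x. \<exists>k. k \<in> M \<and> y \<in> ?V k" by blast
    then obtain h where h: "\<forall>y\<in>elts x. h y \<in> M \<and> y \<in> ?V (h y)" by metis
    then obtain k where k: "k \<in> M" "h ` elts x \<subseteq> underS ?r k"
      using bounded[OF replacement, of h x] by blast
    have "in_level elts ?r k x"
    proof (rule in_levelI)
      fix y assume "y \<in> elts x"
      then show "\<exists>j\<in>underS ?r k. in_level elts ?r j y" using h k(2) by blast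
    qed
    then show ?case using k(1) by blast
  qed
  \<comment> \<open>A level at least as large as \<open>M\<close> would make \<open>M\<close> a set.
    Since \<open>M\<close> is infinite, the union of \<open>M\<close>-many such levels is no larger
    than \<open>M\<close>.\<close>
  have "|?V k| \<le>o |M|" if "k \<in> M" for k
  proof -
    have "\<not> |M| \<le>o |?V k|" using set_if_card_le[OF _ level[OF that]] M by blast
    moreover have "|?V k| \<le>o |M| \<or> |M| \<le>o |?V k|"
      by (intro ordLeq_total card_of_Well_order)
    ultimately show ?thesis by blast
  qed
  then have "|\<Union>k\<in>M. ?V k| \<le>o |M|"
    by (intro card_of_UNION_ordLeq_infinite infM ordLeq_refl card_of_Card_order ballI)
  moreover have "(\<Union>k\<in>M. ?V k) = UNIV" using exhaust by blast
  ultimately have "|UNIV :: 'u set| \<le>o |M|" by simp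
  then show ?thesis using least[OF assms] by (rule ordLeq_transitive)
qed

lemma not_proper_class_iff:
  fixes C :: "'a set"
  shows "\<not> proper_class elts C \<longleftrightarrow> (\<exists>x. C \<lesssim> elts x)"
proof
  assume "\<exists>x. C \<lesssim> elts x"
  then obtain x f where f: "inj_on f C" "f ` C \<subseteq> elts x" by (auto simp: lepoll_def)
  then obtain y where "f ` C = elts y" using separation by blast
  then have "C \<approx> elts y" using f(1) by (auto simp: eqpoll_def bij_betw_def)
  then show "\<not> proper_class elts C" by (auto simp: proper_class_def)
qed (auto simp: proper_class_def dest: eqpoll_imp_lepoll)

text \<open>Cardinals are comparable, so otherwise \<open>C\<close> would inject into the universe,
  and its image, smaller than the universe, would be a set by limitation of size.\<close>

lemma UNIV_lepoll_proper_class: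
  fixes C :: "'a set"
  assumes "proper_class elts C"
  shows "(UNIV :: 'u set) \<lesssim> C"
proof (rule ccontr)
  assume nle: "\<not> (UNIV :: 'u set) \<lesssim> C"
  moreover have "|C| \<le>o |UNIV :: 'u set| \<or> |UNIV :: 'u set| \<le>o |C|"
    by (intro ordLeq_total card_of_Well_order)
  ultimately have "C \<lesssim> (UNIV :: 'u set)" by (simp add: lepoll_iff_card_of)
  then obtain f :: "'a \<Rightarrow> 'u" where f: "inj_on f C" by (auto simp: lepoll_def)
  have "\<not> |UNIV :: 'u set| \<le>o |f ` C|"
    using nle lepoll_trans[OF _ image_lepoll[of f C]] by (auto simp flip: lepoll_iff_card_of)
  then obtain x where "f ` C = elts x" using limitation_of_size by blast
  then have "C \<lesssim> elts x" using f unfolding lepoll_def by blast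
  then show False using assms not_proper_class_iff by blast
qed

section \<open>Families of generators\<close>

lemma family_of_generators_standard: "family_of_generators elts (standard_generators elts)"
  unfolding family_of_generators_def
proof (intro conjI ballI impI standard_generators_subset)
  fix X Y \<phi> \<psi>
  assume X: "X \<in> set_system_hypergraphs elts" and hom: "\<phi> \<in> hhom X Y" "\<psi> \<in> hhom X Y"
    and ne: "\<phi> \<noteq> \<psi>"
  let ?sep = "\<lambda>J \<theta>. \<theta> \<in> hhom J X \<and> hcomp J \<phi> \<theta> \<noteq> hcomp J \<psi> \<theta>"
  let ?o = "one_elt elts"
  consider v where "v \<in> verts X" "fst \<phi> v \<noteq> fst \<psi> v"
    | e where "e \<in> edges X" "snd \<phi> e \<noteq> snd \<psi> e"
  proof (rule ccontr)
    assume "\<not> thesis"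
    then have "\<forall>v\<in>verts X. fst \<phi> v = fst \<psi> v" "\<forall>e\<in>edges X. snd \<phi> e = snd \<psi> e"
      using that by blast+
    moreover have "fst \<phi> \<in> verts X \<rightarrow>\<^sub>E verts Y" "fst \<psi> \<in> verts X \<rightarrow>\<^sub>E verts Y"
      "snd \<phi> \<in> edges X \<rightarrow>\<^sub>E edges Y" "snd \<psi> \<in> edges X \<rightarrow>\<^sub>E edges Y"
      using hom by (auto simp: hhom_def)
    ultimately have "fst \<phi> = fst \<psi>" "snd \<phi> = snd \<psi>"
      using PiE_ext by blast+
    then show False using ne by (simp add: prod_eq_iff)
  qed
  then have "\<exists>J\<in>standard_generators elts. \<exists>\<theta>. ?sep J \<theta>"
  proof cases
    case 1
    \<comment> \<open>The morphism that picks out \<open>v\<close>; its edge map is the empty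
      function.\<close>
    let ?\<theta> = "(\<lambda>u\<in>{?o}. v, \<lambda>e. undefined)"
    have "?sep (one_vertex_hypergraph elts) ?\<theta>"
      using 1 by (auto simp: hhom_def hcomp_def one_vertex_hypergraph_def compose_def
          dest!: fun_cong[where x = ?o])
    then show ?thesis unfolding standard_generators_def by blast
  next
    case 2
    let ?S = "inc X e"
    \<comment> \<open>The inclusion of the endpoints of \<open>e\<close>, with the single edge sent
      to \<open>e\<close>.\<close>
    let ?\<theta> = "(\<lambda>u\<in>?S. u, \<lambda>u\<in>{?o}. e)"
    have S: "?S \<subseteq> verts X" "?S \<in> range elts"
      using X 2 subset_set by (auto simp: set_system_hypergraphs_def PiE_iff)
    then have "?sep (one_edge_hypergraph elts ?S) ?\<theta>"
      using 2 by (auto simp: hhom_def hcomp_def one_edge_hypergraph_def compose_def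
          dest!: fun_cong[where x = ?o])
    then show ?thesis using S unfolding standard_generators_def by blast
  qed
  then show "\<exists>J\<in>standard_generators elts. \<exists>\<theta>\<in>hhom J X. hcomp J \<phi> \<theta> \<noteq> hcomp J \<psi> \<theta>" by blast
qed

text \<open>Two morphisms from \<open>X\<close> to \<open>Y\<close> that differ only in which of two
  parallel edges they hit can be separated only by some \<open>J\<close> with an edge. That edge
  lands on the only edge of \<open>X\<close>, whose endpoints are all of \<open>S\<close>.\<close>

lemma generator_edge_covers:
  assumes gen: "family_of_generators elts \<J>" and S: "S \<in> range elts"
  obtains J e f where "J \<in> \<J>" "e \<in> edges J" "f ` inc J e = S"
proof -
  let ?o = "one_elt elts" and ?z = "empty_elt elts"
  define X where "X = one_edge_hypergraph elts S"
  define Y where "Y = \<lparr>verts = S, edges = {?o, ?z}, inc = (\<lambda>e\<in>{?o, ?z}. S)\<rparr>"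
  define \<phi> :: "'u \<Rightarrow> 'u hmorphism" where "\<phi> c = (\<lambda>u\<in>S. u, \<lambda>u\<in>{?o}. c)" for c
  have "X \<in> set_system_hypergraphs elts"
    using standard_generators_subset S by (auto simp: X_def standard_generators_def)
  moreover have "Y \<in> set_system_hypergraphs elts"
    using S by (auto simp: set_system_hypergraphs_def Y_def finite_set)
  moreover have "\<phi> ?o \<in> hhom X Y" "\<phi> ?z \<in> hhom X Y"
    by (auto simp: hhom_def X_def Y_def \<phi>_def one_edge_hypergraph_def)
  moreover have "?o \<noteq> ?z" using elts_one_elt elts_empty_elt by force
  then have "\<phi> ?o \<noteq> \<phi> ?z" by (auto simp: \<phi>_def dest!: fun_cong[where x = ?o])
  ultimately obtain J \<theta> where J: "J \<in> \<J>" "\<theta> \<in> hhom J X" "hcomp J (\<phi> ?o) \<theta> \<noteq> hcomp J (\<phi> ?z) \<theta>"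
    using gen unfolding family_of_generators_def by metis
  have "edges J \<noteq> {}"
    using J(3) by (auto simp: hcomp_def \<phi>_def compose_def)
  then obtain e where e: "e \<in> edges J" by blast
  then have "fst \<theta> ` inc J e = S"
    using J(2) by (force simp: hhom_def X_def one_edge_hypergraph_def)
  then show ?thesis using that J(1) e by blast
qed

text \<open>Otherwise all vertices of the generators would lie in one set \<open>u\<close>, and an
  edge covering the power set of \<open>u\<close> would contradict Cantor's theorem.\<close>

lemma family_of_generators_proper_class:
  assumes gen: "family_of_generators elts \<J>"
  shows "proper_class elts \<J>"
  unfolding proper_class_def
proof
  assume "\<exists>x. \<J> \<approx> elts x"
  then obtain x where "elts x \<approx> \<J>" using eqpoll_sym by blast
  then obtain h where h: "h ` elts x = \<J>" by (auto simp: eqpoll_def bij_betw_def)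
  have hyp: "J \<in> set_system_hypergraphs elts" if "J \<in> \<J>" for J
    using gen that by (auto simp: family_of_generators_def)
  have "(\<Union>y\<in>elts x. verts (h y)) \<in> range elts"
    using h hyp by (intro UNION_set) (auto simp: set_system_hypergraphs_def)
  then obtain u where u: "elts u = (\<Union>y\<in>elts x. verts (h y))" by blast
  obtain J e f where J: "J \<in> \<J>" "e \<in> edges J" and f: "f ` inc J e = {y. elts y \<subseteq> elts u}"
    using generator_edge_covers[OF gen powerset] by metis
  have inc: "inc J e \<subseteq> elts u"
  proof -
    have "inc J e \<subseteq> verts J"
      using J(2) hyp[OF J(1)] by (auto simp: set_system_hypergraphs_def PiE_iff)
    then show ?thesis using J(1) h u by blast
  qed
  \<comment> \<open>Cantor's diagonal set for \<open>f\<close>; as a subset of \<open>u\<close> it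
    would have to be a value of \<open>f\<close> on \<open>inc J e\<close>.\<close>
  have "{v \<in> inc J e. v \<notin> elts (f v)} \<in> range elts"
    by (rule separation[of _ u]) (use inc in blast)
  then obtain d where d: "elts d = {v \<in> inc J e. v \<notin> elts (f v)}" by blast
  then have "d \<in> f ` inc J e" using f inc by auto
  then show False using d by blast
qed

text \<open>Sets code the generators: the singleton of \<open>z\<close> stands for the one-edge
  hypergraph on \<open>elts z\<close>, any other set, such as the empty one, for the one-vertex
  hypergraph.\<close>

lemma standard_generators_lepoll_UNIV: "standard_generators elts \<lesssim> (UNIV :: 'u set)"
proof -
  define g where "g u = (if \<exists>z. elts u = {z} then one_edge_hypergraph elts (elts (THE z. elts u = {z}))
    else one_vertex_hypergraph elts)" for u
  have "one_vertex_hypergraph elts = g (empty_elt elts)" by (simp add: g_def elts_empty_elt)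
  moreover have "\<exists>u. one_edge_hypergraph elts (elts z) = g u" for z
  proof -
    obtain u where "elts u = {z}" using singleton_set[of z] by (metis imageE)
    then have "one_edge_hypergraph elts (elts z) = g u" by (auto simp: g_def)
    then show ?thesis ..
  qed
  ultimately have "standard_generators elts \<subseteq> range g"
    by (auto simp: standard_generators_def)
  then show ?thesis by (rule subset_image_lepoll)
qed

end

theorem mainTheorem7:
  fixes elts :: "'u \<Rightarrow> 'u set"
  assumes "zfc_universe elts"
  shows "family_of_generators elts (standard_generators elts) \<and>
         (\<forall>\<J>. family_of_generators elts \<J> \<longrightarrow> proper_class elts \<J>) \<and>
         minimal_family_of_generators elts (standard_generators elts)"
proof -
  interpret zfc_universe elts by fact
  show ?thesis
    unfolding minimal_family_of_generators_def
    using family_of_generators_standard family_of_generators_proper_class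
      lepoll_trans[OF standard_generators_lepoll_UNIV UNIV_lepoll_proper_class]
    by blast
qed

end
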